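(* Let $G$ be a graph and $v\in V(G)$. If $v$ is not a coloop of $M_A(G)$ then $M_A(G)-v = M_A(G-v)$.
   Context: Graphs are finite and may have loops and parallel edges. $\mathcal{A}(G)$ is the symmetric $V(G)\times V(G)$ matrix over $GF(2)$ with $a_{vv}=1$ iff $v$ is looped and, for $v\ne w$, $a_{vw}=1$ iff $v,w$ are adjacent. The adjacency matroid $M_A(G)$ is the binary matroid on $V(G)$ whose circuits are the minimal nonempty $S\subseteq V(G)$ such that the columns of $\mathcal{A}(G)$ indexed by $S$ are linearly dependent over $GF(2)$. $G-v$ is the full subgraph induced by $V(G)\setminus\{v\}$. For a matroid $M$ on $V$ and $v\in V$: $v$ is a coloop of $M$ if it belongs to no circuit of $M$; the deletion $M-v$ is the matroid on $V\setminus\{v\}$ whose circuits are the circuits of $M$ not containing $v$. *)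

theory Defs
  imports "HOL-Library.Z2" "HOL-Library.Uprod"
begin

text \<open>
  Every edge has an unordered pair of end-vertices, and \<open>Upair v v\<close> is the pair of ends of a loop
  at \<open>v\<close>. Distinct edges may have the same ends.
\<close>

record ('v, 'e) multigraph =
  verts :: "'v set"
  edges :: "'e set"
  ends :: "'e \<Rightarrow> 'v uprod"

definition finite_graph :: "('v, 'e) multigraph \<Rightarrow> bool" where
  "finite_graph G \<longleftrightarrow>
     finite (verts G) \<and> finite (edges G) \<and> (\<forall>e\<in>edges G. set_uprod (ends G e) \<subseteq> verts G)"

definition looped :: "('v, 'e) multigraph \<Rightarrow> 'v \<Rightarrow> bool" where
  "looped G v \<longleftrightarrow> (\<exists>e\<in>edges G. ends G e = Upair v v)"

definition adjacent :: "('v, 'e) multigraph \<Rightarrow> 'v \<Rightarrow> 'v \<Rightarrow> bool" where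
  "adjacent G v w \<longleftrightarrow> v \<noteq> w \<and> (\<exists>e\<in>edges G. ends G e = Upair v w)"

definition induced_subgraph :: "('v, 'e) multigraph \<Rightarrow> 'v set \<Rightarrow> ('v, 'e) multigraph" where
  "induced_subgraph G W =
     \<lparr>verts = W, edges = {e \<in> edges G. set_uprod (ends G e) \<subseteq> W}, ends = ends G\<rparr>"

definition delete_vertex :: "('v, 'e) multigraph \<Rightarrow> 'v \<Rightarrow> ('v, 'e) multigraph" where
  "delete_vertex G v = induced_subgraph G (verts G - {v})"


record 'a matroid =
  ground :: "'a set"
  circuits :: "'a set set"

definition is_matroid :: "'a matroid \<Rightarrow> bool" where
  "is_matroid M \<longleftrightarrow>
     finite (ground M) \<and>
     (\<forall>C\<in>circuits M. C \<noteq> {} \<and> C \<subseteq> ground M) \<and>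
     (\<forall>C\<in>circuits M. \<forall>D\<in>circuits M. C \<subseteq> D \<longrightarrow> C = D) \<and>
     (\<forall>C\<in>circuits M. \<forall>D\<in>circuits M. C \<noteq> D \<longrightarrow>
        (\<forall>x\<in>C \<inter> D. \<exists>B\<in>circuits M. B \<subseteq> (C \<union> D) - {x}))"

definition coloop :: "'a matroid \<Rightarrow> 'a \<Rightarrow> bool" where
  "coloop M x \<longleftrightarrow> x \<in> ground M \<and> (\<forall>C\<in>circuits M. x \<notin> C)"

definition matroid_delete :: "'a matroid \<Rightarrow> 'a \<Rightarrow> 'a matroid" where
  "matroid_delete M x = \<lparr>ground = ground M - {x}, circuits = {C \<in> circuits M. x \<notin> C}\<rparr>"

lemma is_matroid_matroid_delete:
  assumes "is_matroid M"
  shows "is_matroid (matroid_delete M x)"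
  unfolding is_matroid_def
proof (intro conjI ballI impI)
  fix C D y
  assume C: "C \<in> circuits (matroid_delete M x)" and D: "D \<in> circuits (matroid_delete M x)"
    and "C \<noteq> D" "y \<in> C \<inter> D"
  then obtain B where "B \<in> circuits M" "B \<subseteq> (C \<union> D) - {y}"
    using assms unfolding is_matroid_def matroid_delete_def by fastforce
  then show "\<exists>B\<in>circuits (matroid_delete M x). B \<subseteq> (C \<union> D) - {y}"
    using C D by (auto simp: matroid_delete_def)
qed (use assms in \<open>auto simp: is_matroid_def matroid_delete_def\<close>)


text \<open>
  A matrix over $GF(2)$ (the type \<open>bit\<close>) with rows indexed by \<open>R\<close> is a function of the row and
  column index. Dependence is that of the indexed family of columns, so two equal columns with
  different indices are dependent; columns are vectors in $GF(2)^R$, so only rows in \<open>R\<close> count.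
\<close>

definition columns_dependent :: "'r set \<Rightarrow> ('r \<Rightarrow> 'c \<Rightarrow> bit) \<Rightarrow> 'c set \<Rightarrow> bool" where
  "columns_dependent R A S \<longleftrightarrow>
     (\<exists>c :: 'c \<Rightarrow> bit. (\<exists>s\<in>S. c s \<noteq> 0) \<and> (\<forall>r\<in>R. (\<Sum>s\<in>S. c s * A r s) = 0))"

definition binary_matroid :: "'r set \<Rightarrow> 'c set \<Rightarrow> ('r \<Rightarrow> 'c \<Rightarrow> bit) \<Rightarrow> 'c matroid" where
  "binary_matroid R E A =
     \<lparr>ground = E,
      circuits = {S. S \<subseteq> E \<and> S \<noteq> {} \<and> columns_dependent R A S \<and>
                     (\<forall>T. T \<subset> S \<and> T \<noteq> {} \<longrightarrow> \<not> columns_dependent R A T)}\<rparr>"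

definition adjacency_matrix :: "('v, 'e) multigraph \<Rightarrow> 'v \<Rightarrow> 'v \<Rightarrow> bit" where
  "adjacency_matrix G v w =
     (if v = w then of_bool (looped G v) else of_bool (adjacent G v w))"

definition adjacency_matroid :: "('v, 'e) multigraph \<Rightarrow> 'v matroid" where
  "adjacency_matroid G = binary_matroid (verts G) (verts G) (adjacency_matrix G)"

lemma columns_dependent_iff:
  assumes "finite S"
  shows "columns_dependent R A S \<longleftrightarrow>
           (\<exists>T. T \<subseteq> S \<and> T \<noteq> {} \<and> (\<forall>r\<in>R. (\<Sum>s\<in>T. A r s) = 0))"
proof
  assume "columns_dependent R A S"
  then obtain c :: "_ \<Rightarrow> bit" where c: "\<exists>s\<in>S. c s \<noteq> 0" "\<forall>r\<in>R. (\<Sum>s\<in>S. c s * A r s) = 0"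
    unfolding columns_dependent_def by blast
  have "(\<Sum>s\<in>{s\<in>S. c s \<noteq> 0}. A r s) = (\<Sum>s\<in>S. c s * A r s)" for r
    using assms by (intro sum.mono_neutral_cong_left) auto
  with c show "\<exists>T. T \<subseteq> S \<and> T \<noteq> {} \<and> (\<forall>r\<in>R. (\<Sum>s\<in>T. A r s) = 0)"
    by (intro exI[of _ "{s\<in>S. c s \<noteq> 0}"]) auto
next
  assume "\<exists>T. T \<subseteq> S \<and> T \<noteq> {} \<and> (\<forall>r\<in>R. (\<Sum>s\<in>T. A r s) = 0)"
  then obtain T where T: "T \<subseteq> S" "T \<noteq> {}" "\<forall>r\<in>R. (\<Sum>s\<in>T. A r s) = 0" by blast
  have "(\<Sum>s\<in>S. of_bool (s \<in> T) * A r s) = (\<Sum>s\<in>T. A r s)" for r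
    using assms T(1) by (intro sum.mono_neutral_cong_right) auto
  with T show "columns_dependent R A S"
    unfolding columns_dependent_def by (intro exI[of _ "\<lambda>s. of_bool (s \<in> T)"]) auto
qed

lemma binary_matroid_contains_circuit:
  assumes "finite S" "S \<subseteq> E" "columns_dependent R A S"
  shows "\<exists>C\<in>circuits (binary_matroid R E A). C \<subseteq> S"
  using assms
proof (induction S rule: finite_psubset_induct)
  case (psubset S)
  have ne: "S \<noteq> {}" using psubset.prems by (auto simp: columns_dependent_def)
  show ?case
  proof (cases "\<exists>T. T \<subset> S \<and> T \<noteq> {} \<and> columns_dependent R A T")
    case True
    then obtain T where T: "T \<subset> S" "columns_dependent R A T" by blast
    then obtain C where "C \<in> circuits (binary_matroid R E A)" "C \<subseteq> T"
      using psubset.IH[of T] psubset.prems by blast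
    with T show ?thesis by blast
  next
    case False
    then have "S \<in> circuits (binary_matroid R E A)"
      using ne psubset.prems by (auto simp: binary_matroid_def)
    then show ?thesis by blast
  qed
qed

lemma binary_matroid_circuit_sum:
  assumes "finite E" "C \<in> circuits (binary_matroid R E A)" "r \<in> R"
  shows "(\<Sum>s\<in>C. A r s) = 0"
proof -
  have C: "C \<subseteq> E" "columns_dependent R A C"
    "\<And>T. T \<subset> C \<Longrightarrow> T \<noteq> {} \<Longrightarrow> \<not> columns_dependent R A T"
    using assms(2) by (auto simp: binary_matroid_def)
  have fin: "finite C" using C(1) assms(1) by (rule finite_subset)
  then obtain T where T: "T \<subseteq> C" "T \<noteq> {}" "\<forall>r\<in>R. (\<Sum>s\<in>T. A r s) = 0"
    using C(2) columns_dependent_iff by metis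
  then have "columns_dependent R A T"
    using columns_dependent_iff[OF finite_subset[OF T(1) fin]] by blast
  then have "T = C" using C(3) T by blast
  then show ?thesis using T(3) assms(3) by blast
qed

lemma bit_add_eq_0_iff: "a + b = 0 \<longleftrightarrow> a = b" for a b :: bit
  by (cases a; cases b) simp_all

lemma is_matroid_binary_matroid:
  assumes "finite E"
  shows "is_matroid (binary_matroid R E A)"
  unfolding is_matroid_def
proof (intro conjI ballI impI)
  let ?M = "binary_matroid R E A"
  fix C D x
  assume CD: "C \<in> circuits ?M" "D \<in> circuits ?M" and neq: "C \<noteq> D" and x: "x \<in> C \<inter> D"
  define S where "S = (C - D) \<union> (D - C)"
  have sub: "C \<subseteq> E" "D \<subseteq> E" using CD by (auto simp: binary_matroid_def)
  then have fin: "finite C" "finite D" using assms finite_subset by auto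
  have "(\<Sum>s\<in>S. A r s) = 0" if "r \<in> R" for r
  proof -
    have "(\<Sum>s\<in>S. A r s) = (\<Sum>s\<in>C - D. A r s) + (\<Sum>s\<in>D - C. A r s)"
      unfolding S_def using fin by (intro sum.union_disjoint) auto
    also have "(\<Sum>s\<in>C - D. A r s) = (\<Sum>s\<in>C \<inter> D. A r s)"
      using sum.Int_Diff[OF fin(1), of "A r" D] binary_matroid_circuit_sum[OF assms CD(1) that]
      by (metis bit_add_eq_0_iff)
    also have "(\<Sum>s\<in>D - C. A r s) = (\<Sum>s\<in>C \<inter> D. A r s)"
      using sum.Int_Diff[OF fin(2), of "A r" C] binary_matroid_circuit_sum[OF assms CD(2) that]
      by (metis bit_add_eq_0_iff Int_commute)
    finally show ?thesis by (simp only: bit_add_eq_0_iff)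
  qed
  moreover have "S \<noteq> {}" using neq by (auto simp: S_def)
  moreover have finS: "finite S" using fin by (simp add: S_def)
  ultimately have "columns_dependent R A S"
    unfolding columns_dependent_iff[OF finS] by (intro exI[of _ S]) simp
  moreover have "S \<subseteq> E" using sub by (auto simp: S_def)
  ultimately obtain B where "B \<in> circuits ?M" "B \<subseteq> S"
    using binary_matroid_contains_circuit[OF finS] by blast
  then show "\<exists>B\<in>circuits ?M. B \<subseteq> (C \<union> D) - {x}"
    using x by (intro bexI[of _ B]) (auto simp: S_def)
next
  show "finite (ground (binary_matroid R E A))"
    using assms by (simp add: binary_matroid_def)
next
  fix C assume "C \<in> circuits (binary_matroid R E A)"
  then show "C \<noteq> {}" "C \<subseteq> ground (binary_matroid R E A)"
    by (simp_all add: binary_matroid_def)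
next
  fix C D
  assume "C \<in> circuits (binary_matroid R E A)" "D \<in> circuits (binary_matroid R E A)" "C \<subseteq> D"
  then show "C = D"
    unfolding binary_matroid_def by (simp add: psubset_eq) metis
qed

lemma is_matroid_adjacency_matroid:
  "finite_graph G \<Longrightarrow> is_matroid (adjacency_matroid G)"
  by (simp add: adjacency_matroid_def finite_graph_def is_matroid_binary_matroid)

lemma finite_graph_delete_vertex:
  "finite_graph G \<Longrightarrow> finite_graph (delete_vertex G v)"
  by (auto simp: finite_graph_def delete_vertex_def induced_subgraph_def)

end

theory Submission
  imports Defs
begin

text \<open>
  Deleting \<open>v\<close> from \<open>G\<close> removes both the column and the row of \<open>v\<close> from the adjacency matrix,
  whereas deleting \<open>v\<close> from the matroid removes the column only. The two agree once the row of \<open>v\<close>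
  is redundant. If \<open>v\<close> is not a coloop, it lies in a circuit \<open>C\<close>, and the columns indexed by \<open>C\<close>
  sum to zero. The matrix is symmetric, so the rows indexed by \<open>C\<close> sum to zero as well, and
  the row of \<open>v\<close> is the sum of the rows indexed by \<open>C - {v}\<close>. A linear relation among columns that
  holds in all the other rows therefore holds in the row of \<open>v\<close> too
  (\<open>columns_dependent_remove_redundant_row\<close>).
\<close>

lemma adjacency_matrix_sym: "adjacency_matrix G u w = adjacency_matrix G w u"
proof -
  have "Upair u w = Upair w u"
    by simp
  then show ?thesis
    by (auto simp: adjacency_matrix_def adjacent_def simp del: Upair_inject)
qed

lemma adjacency_matrix_induced_subgraph:
  assumes "u \<in> W" "w \<in> W"
  shows "adjacency_matrix (induced_subgraph G W) u w = adjacency_matrix G u w"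
proof -
  have "(\<exists>e\<in>edges (induced_subgraph G W). ends (induced_subgraph G W) e = Upair u w) \<longleftrightarrow>
        (\<exists>e\<in>edges G. ends G e = Upair u w)"
    using assms by (auto simp: induced_subgraph_def)
  then show ?thesis
    by (cases "u = w") (simp_all add: adjacency_matrix_def looped_def adjacent_def)
qed

lemma binary_matroid_cong:
  assumes "\<And>S. S \<subseteq> E \<Longrightarrow> columns_dependent R A S \<longleftrightarrow> columns_dependent R' A' S"
  shows "binary_matroid R E A = binary_matroid R' E A'"
proof -
  have "columns_dependent R A T \<longleftrightarrow> columns_dependent R' A' T" if "T \<subset> S" "S \<subseteq> E" for S T
    using assms[of T] that by blast
  with assms show ?thesis
    unfolding binary_matroid_def by (auto; blast)
qed

lemma matroid_delete_binary_matroid: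
  "matroid_delete (binary_matroid R E A) x = binary_matroid R (E - {x}) A"
  by (auto simp: matroid_delete_def binary_matroid_def)

lemma columns_dependent_cong:
  assumes "\<And>r s. r \<in> R \<Longrightarrow> s \<in> S \<Longrightarrow> A r s = B r s"
  shows "columns_dependent R A S \<longleftrightarrow> columns_dependent R B S"
  using assms by (simp add: columns_dependent_def cong: sum.cong)

lemma columns_dependent_remove_redundant_row:
  assumes T: "T \<subseteq> R - {x}"
    and row: "\<And>s. s \<in> S \<Longrightarrow> A x s = (\<Sum>r\<in>T. A r s)"
  shows "columns_dependent R A S \<longleftrightarrow> columns_dependent (R - {x}) A S"
proof -
  have "(\<Sum>s\<in>S. c s * A x s) = 0"
    if c: "\<forall>r\<in>R - {x}. (\<Sum>s\<in>S. c s * A r s) = 0" for c :: "_ \<Rightarrow> bit"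
  proof -
    have "(\<Sum>s\<in>S. c s * A x s) = (\<Sum>s\<in>S. \<Sum>r\<in>T. c s * A r s)"
      by (intro sum.cong) (simp_all only: row sum_distrib_left)
    also have "\<dots> = (\<Sum>r\<in>T. \<Sum>s\<in>S. c s * A r s)"
      by (rule sum.swap)
    also have "\<dots> = 0"
      using c T by (intro sum.neutral) blast
    finally show ?thesis .
  qed
  then have "(\<forall>r\<in>R. (\<Sum>s\<in>S. c s * A r s) = 0) \<longleftrightarrow>
             (\<forall>r\<in>R - {x}. (\<Sum>s\<in>S. c s * A r s) = 0)" for c :: "_ \<Rightarrow> bit"
    by blast
  then show ?thesis
    by (simp only: columns_dependent_def)
qed

text \<open>
  Symmetry turns the column relation given by a circuit through \<open>x\<close> into a relation between rows,
  and over \<open>GF(2)\<close> every entry of that relation can be expressed by the others.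
\<close>

lemma symmetric_non_coloop_row_redundant:
  assumes fin: "finite E"
    and sym: "\<And>r s. r \<in> E \<Longrightarrow> s \<in> E \<Longrightarrow> A r s = A s r"
    and x: "x \<in> E" "\<not> coloop (binary_matroid E E A) x"
  obtains T where "T \<subseteq> E - {x}" "\<And>s. s \<in> E \<Longrightarrow> A x s = (\<Sum>r\<in>T. A r s)"
proof -
  obtain C where C: "C \<in> circuits (binary_matroid E E A)" "x \<in> C"
    using x by (auto simp: coloop_def binary_matroid_def)
  have CE: "C \<subseteq> E"
    using C(1) by (simp add: binary_matroid_def)
  have "A x s = (\<Sum>r\<in>C - {x}. A r s)" if s: "s \<in> E" for s
  proof -
    have "A x s + (\<Sum>r\<in>C - {x}. A r s) = (\<Sum>r\<in>C. A r s)"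
      using sum.remove[OF finite_subset[OF CE fin] C(2)] by metis
    also have "\<dots> = (\<Sum>r\<in>C. A s r)"
      using CE s by (intro sum.cong sym) auto
    also have "\<dots> = 0"
      using binary_matroid_circuit_sum[OF fin C(1) s] .
    finally show ?thesis
      by (simp only: bit_add_eq_0_iff)
  qed
  with CE show thesis
    by (intro that[of "C - {x}"]) auto
qed

theorem theorem17:
  fixes G :: "('v, 'e) multigraph" and v :: 'v
  assumes "finite_graph G" and "v \<in> verts G"
    and "\<not> coloop (adjacency_matroid G) v"
  shows "matroid_delete (adjacency_matroid G) v = adjacency_matroid (delete_vertex G v)"
proof -
  let ?V = "verts G" and ?A = "adjacency_matrix G"
  have fin: "finite ?V"
    using assms(1) by (simp add: finite_graph_def)
  have non_coloop: "\<not> coloop (binary_matroid ?V ?V ?A) v"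
    using assms(3) by (simp add: adjacency_matroid_def)
  obtain T where T: "T \<subseteq> ?V - {v}" "\<And>s. s \<in> ?V \<Longrightarrow> ?A v s = (\<Sum>r\<in>T. ?A r s)"
    using symmetric_non_coloop_row_redundant[OF fin adjacency_matrix_sym assms(2) non_coloop]
    by blast
  have "columns_dependent ?V ?A S \<longleftrightarrow>
        columns_dependent (?V - {v}) (adjacency_matrix (delete_vertex G v)) S"
    if S: "S \<subseteq> ?V - {v}" for S
  proof -
    have "columns_dependent ?V ?A S \<longleftrightarrow> columns_dependent (?V - {v}) ?A S"
      using S by (intro columns_dependent_remove_redundant_row[OF T(1)] T(2)) auto
    also have "\<dots> \<longleftrightarrow> columns_dependent (?V - {v}) (adjacency_matrix (delete_vertex G v)) S"
      unfolding delete_vertex_def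
      using S by (intro columns_dependent_cong adjacency_matrix_induced_subgraph[symmetric]) auto
    finally show ?thesis .
  qed
  then have "binary_matroid ?V (?V - {v}) ?A =
             binary_matroid (?V - {v}) (?V - {v}) (adjacency_matrix (delete_vertex G v))"
    by (rule binary_matroid_cong)
  moreover have "verts (delete_vertex G v) = ?V - {v}"
    by (simp add: delete_vertex_def induced_subgraph_def)
  ultimately show ?thesis
    by (simp add: adjacency_matroid_def matroid_delete_binary_matroid)
qed

end
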